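(* Let $k,\ell$ be integers such that $0 \leq k \leq \ell \leq 2k-1$, and let $G=(V,E)$ be a simple undirected graph. Then the polytope $P_{k,\ell}(G)$ of the $(k,\ell)$-tight subgraphs of $G$, that is, the convex hull in $\mathbb{R}^E$ of the incidence vectors of all edge subsets $F\subseteq E$ such that $(V,F)$ is $(k,\ell)$-tight, has an extended formulation of size $O(|V|^2|E|)$.
   Context: Let $k,\ell$ be integers with $0\le \ell\le 2k-1$. A simple undirected graph $H=(V,F)$ is $(k,\ell)$-sparse if $|F'| \leq \max\{k|V(F')|-\ell,\,0\}$ for every $F'\subseteq F$, where $V(F')$ is the set of vertices of $H$ incident to at least one edge of $F'$. It is $(k,\ell)$-tight if it is $(k,\ell)$-sparse and $|F|=\max\{k|V|-\ell,\,0\}$. For a simple undirected graph $G=(V,E)$, let $\mathcal{F}_{k,\ell}(G)\subseteq 2^E$ be the family of all $F\subseteq E$ such that the graph $(V,F)$ (on the full vertex set $V$) is $(k,\ell)$-tight, and let $$P_{k,\ell}(G)=\mathrm{conv}(\{\chi_F\in\mathbb{R}^E \mid F\in\mathcal{F}_{k,\ell}(G)\}),$$ where $\chi_F$ is the incidence vector of $F$. An extended formulation of a convex polytope $P\subseteq\mathbb{R}^d$ is a polytope $Q\subseteq\mathbb{R}^p$, $p\ge d$, such that there exists a linear projection $\pi\colon\mathbb{R}^p\to\mathbb{R}^d$ with $\pi(Q)=P$. The size of an extended formulation $Q$ is the number of facets of $Q$. *)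

theory Defs
  imports "HOL-Analysis.Analysis" "HOL-Analysis.Finite_Function_Topology"
begin

text \<open>
  Dimensions vary inside the statement, so \<open>\<real>\<^sup>I\<close> for a finite index set \<open>I\<close> is rendered as the
  subspace \<open>coord_space I\<close> of the real vector space of finitely supported functions;
  \<open>\<real>\<^sup>p\<close> is \<open>coord_space {..<p}\<close>. The library notions \<^const>\<open>hull\<close>, \<^const>\<open>polytope\<close>,
  \<^const>\<open>face_of\<close> and \<^const>\<open>linear\<close> apply to this space directly.
\<close>

definition coord_space :: "'i set \<Rightarrow> ('i \<Rightarrow>\<^sub>0 real) set" where
  "coord_space I = {x. Poly_Mapping.keys x \<subseteq> I}"

text \<open>
  The library's \<^const>\<open>aff_dim\<close> and \<^const>\<open>facet_of\<close> are confined to Euclidean types. The following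
  are the same definitions for arbitrary real vector spaces; \<open>affine_dimension\<close> is meaningful
  for sets that lie in a finite-dimensional subspace.
\<close>

definition affine_dimension :: "'a::real_vector set \<Rightarrow> int" where
  "affine_dimension S =
    (SOME d. \<exists>B. finite B \<and> affine hull B = affine hull S \<and> \<not> affine_dependent B
                 \<and> int (card B) = d + 1)"

definition is_facet :: "'a::real_vector set \<Rightarrow> 'a set \<Rightarrow> bool" where
  "is_facet F S \<longleftrightarrow> F face_of S \<and> F \<noteq> {} \<and> affine_dimension F = affine_dimension S - 1"

lemma affine_dimension_eq_aff_dim:
  fixes S :: "'a::euclidean_space set"
  shows "affine_dimension S = aff_dim S"
proof -
  have "(finite B \<and> affine hull B = affine hull S \<and> \<not> affine_dependent B \<and> int (card B) = d + 1)
      \<longleftrightarrow> (affine hull B = affine hull S \<and> \<not> affine_dependent B \<and> int (card B) = d + 1)"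
    for B d using aff_independent_finite by blast
  then show ?thesis
    unfolding affine_dimension_def aff_dim_def by simp
qed

lemma is_facet_iff_facet_of:
  fixes S :: "'a::euclidean_space set"
  shows "is_facet F S \<longleftrightarrow> F facet_of S"
  by (simp add: is_facet_def facet_of_def affine_dimension_eq_aff_dim)

definition num_facets :: "'a::real_vector set \<Rightarrow> nat" where
  "num_facets Q = card {F. is_facet F Q}"

definition extended_formulation ::
    "'i set \<Rightarrow> ('i \<Rightarrow>\<^sub>0 real) set \<Rightarrow> nat \<Rightarrow> (nat \<Rightarrow>\<^sub>0 real) set \<Rightarrow> bool" where
  "extended_formulation I P p Q \<longleftrightarrow>
     card I \<le> p \<and> polytope Q \<and> Q \<subseteq> coord_space {..<p} \<and>
     (\<exists>\<pi>. linear \<pi> \<and> \<pi> ` coord_space {..<p} = coord_space I \<and> \<pi> ` Q = P)"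

definition simple_graph :: "'v set \<Rightarrow> 'v set set \<Rightarrow> bool" where
  "simple_graph V E \<longleftrightarrow> finite V \<and> (\<forall>e\<in>E. e \<subseteq> V \<and> card e = 2)"

text \<open>The set \<open>\<Union>F'\<close> consists of the vertices incident to an edge of \<open>F'\<close>.\<close>

definition sparse :: "int \<Rightarrow> int \<Rightarrow> 'v set set \<Rightarrow> bool" where
  "sparse k l F \<longleftrightarrow> (\<forall>F'\<subseteq>F. int (card F') \<le> max (k * int (card (\<Union>F')) - l) 0)"

definition tight :: "int \<Rightarrow> int \<Rightarrow> 'v set \<Rightarrow> 'v set set \<Rightarrow> bool" where
  "tight k l V F \<longleftrightarrow> sparse k l F \<and> int (card F) = max (k * int (card V) - l) 0"

definition incidence_vector :: "'e set \<Rightarrow> ('e \<Rightarrow>\<^sub>0 real)" where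
  "incidence_vector F = (\<Sum>e\<in>F. Poly_Mapping.single e 1)"

definition tight_polytope :: "int \<Rightarrow> int \<Rightarrow> 'v set \<Rightarrow> 'v set set \<Rightarrow> ('v set \<Rightarrow>\<^sub>0 real) set" where
  "tight_polytope k l V E = convex hull {incidence_vector F | F. F \<subseteq> E \<and> tight k l V F}"

end

theory Submission
  imports Defs
begin

text \<open>
  For distinct vertices \<open>u\<close>, \<open>v\<close>, a tight edge set can be oriented so that \<open>u\<close> has in-degree \<open>0\<close>,
  \<open>v\<close> has in-degree \<open>2 * k - l\<close> and every other vertex has in-degree \<open>k\<close>. Conversely, if an edge
  weighting \<open>x\<close> has a fractional orientation with these in-degrees, then adding the in-degrees over
  a vertex set \<open>U\<close> containing \<open>u\<close> and \<open>v\<close> shows that \<open>x\<close> has weight at most \<open>k * card U - l\<close>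
  inside \<open>U\<close>. So the weightings \<open>x \<le> 1\<close> with a fractional orientation for every pair
  \<open>(u, v)\<close> form the polytope of the count inequalities, which is integral by uncrossing; the
  nonnegativity of the \<open>O(|V|\<^sup>2 |E|)\<close> orientation variables supplies almost all the facets.
\<close>

subsection \<open>Affine dimension\<close>

text \<open>Moving a point \<open>a\<close> of \<open>B\<close> and a point \<open>c\<close> of
  \<open>C\<close> to the origin turns affine independence into linear independence and the affine
  hull into a span, so the linear exchange bound applies.\<close>

lemma affine_independent_card_le:
  fixes B C :: "'a::real_vector set"
  assumes ind: "\<not> affine_dependent B" and sub: "B \<subseteq> affine hull C" and fin: "finite C"
  shows "finite B \<and> card B \<le> card C"
proof (cases "B = {}")
  case False
  then obtain a where a: "a \<in> B" by blast
  with sub obtain c where c: "c \<in> C" by (metis affine_hull_eq_empty all_not_in_conv subsetD)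
  let ?X = "(\<lambda>x. - a + x) ` (B - {a})" and ?Y = "(\<lambda>x. - c + x) ` (C - {c})"
  have mem: "- c + b \<in> span ?Y" if "b \<in> B" for b
    using that sub affine_hull_span2[OF c] by fastforce
  have "independent ?X"
    using ind a affine_dependent_iff_dependent2 by blast
  moreover have "?X \<subseteq> span ?Y"
  proof
    fix z assume "z \<in> ?X"
    then obtain b where "b \<in> B" "z = (- c + b) - (- c + a)" by auto
    then show "z \<in> span ?Y"
      using span_diff[OF mem[OF \<open>b \<in> B\<close>] mem[OF a]] by simp
  qed
  ultimately have le: "finite ?X \<and> card ?X \<le> card ?Y"
    using fin by (intro independent_span_bound) auto
  have "card ?X = card (B - {a})" "finite (B - {a})"
    using le by (auto simp: card_image finite_image_iff)
  moreover have "card ?Y = card (C - {c})"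
    by (auto simp: card_image)
  ultimately have "card (B - {a}) \<le> card (C - {c})" "finite B"
    using le by auto
  then show ?thesis
    using a c fin card_Suc_Diff1 [of B a] card_Suc_Diff1 [of C c] by linarith
qed auto

text \<open>The exchange bound in both directions gives all finite affine bases of one hull the same
  size, so the choice in \<open>affine_dimension\<close> is determined.\<close>

lemma affine_dimension_eq_card:
  fixes S :: "'a::real_vector set"
  assumes "finite B" "affine hull B = affine hull S" "\<not> affine_dependent B"
  shows "affine_dimension S = int (card B) - 1"
  unfolding affine_dimension_def
proof (rule some_equality)
  show "\<exists>B'. finite B' \<and> affine hull B' = affine hull S \<and> \<not> affine_dependent B'
           \<and> int (card B') = int (card B) - 1 + 1"
    using assms by auto
next
  fix d
  assume "\<exists>B'. finite B' \<and> affine hull B' = affine hull S \<and> \<not> affine_dependent B'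
           \<and> int (card B') = d + 1"
  then obtain B' where B': "finite B'" "affine hull B' = affine hull S" "\<not> affine_dependent B'"
      "int (card B') = d + 1" by blast
  have "card B' = card B"
    using affine_independent_card_le[of B B'] affine_independent_card_le[of B' B] assms B'
    by (metis hull_subset le_antisym)
  then show "d = int (card B) - 1" using B' by simp
qed

text \<open>An affine basis of \<open>S\<close> extends to one of \<open>T\<close> by at least one
  further point; \<open>C\<close> keeps both bases finite.\<close>

lemma affine_dimension_less:
  fixes S T :: "'a::real_vector set"
  assumes "S \<subseteq> T" "affine hull S \<noteq> affine hull T" "T \<subseteq> affine hull C" "finite C"
  shows "affine_dimension S < affine_dimension T"
proof -
  obtain B where B: "B \<subseteq> S" "\<not> affine_dependent B" "affine hull S = affine hull B"
    using affine_basis_exists by blast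
  then obtain D where D: "\<not> affine_dependent D" "B \<subseteq> D" "D \<subseteq> T" "affine hull D = affine hull T"
    using extend_to_affine_basis[of B T] assms(1) by (metis subset_trans)
  have fin: "finite D"
    using affine_independent_card_le[of D C] D assms by auto
  have "B \<noteq> D" using B D assms(2) by metis
  then have "card B < card D"
    using D(2) fin by (simp add: psubset_card_mono psubset_eq)
  moreover have "affine_dimension S = int (card B) - 1"
    using B D(2) fin finite_subset by (intro affine_dimension_eq_card) auto
  moreover have "affine_dimension T = int (card D) - 1"
    using D fin by (intro affine_dimension_eq_card) auto
  ultimately show ?thesis by simp
qed

subsection \<open>Faces and vertices of polyhedra\<close>

text \<open>Equations live in the affine set \<open>L\<close>, so that \<open>I\<close> indexes only
  inequalities and its size can bound the number of facets.\<close>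

locale polyhedron_rep =
  fixes L :: "'a::real_vector set" and I :: "'k set" and f :: "'k \<Rightarrow> 'a \<Rightarrow> real" and b :: "'k \<Rightarrow> real"
  assumes affine_L: "affine L" and finite_I: "finite I" and linear_f: "\<And>i. i \<in> I \<Longrightarrow> linear (f i)"
begin

definition carrier :: "'a set" where
  "carrier = {x \<in> L. \<forall>i\<in>I. f i x \<le> b i}"

text \<open>Basic feasible solutions: points of the polyhedron that are determined within
  \<open>L\<close> by their active inequalities.\<close>

definition vertices :: "'a set" where
  "vertices = {x \<in> carrier. \<forall>y\<in>L. (\<forall>i\<in>I. f i x = b i \<longrightarrow> f i y = b i) \<longrightarrow> y = x}"

lemma f_line: "i \<in> I \<Longrightarrow> f i (x + t *\<^sub>R (y - x)) = f i x + t * (f i y - f i x)"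
  by (simp add: linear_add linear_scale linear_diff linear_f)

lemma f_comb: "i \<in> I \<Longrightarrow> f i (u *\<^sub>R x + v *\<^sub>R y) = u * f i x + v * f i y"
  by (simp add: linear_add linear_scale linear_f)

lemma L_line: "x \<in> L \<Longrightarrow> y \<in> L \<Longrightarrow> x + t *\<^sub>R (y - x) \<in> L"
proof -
  assume "x \<in> L" "y \<in> L"
  then have "(1 - t) *\<^sub>R x + t *\<^sub>R y \<in> L"
    using affine_L by (simp add: affine_def)
  then show ?thesis by (simp add: algebra_simps)
qed

lemma convex_carrier: "convex carrier"
  unfolding carrier_def
proof (rule convexI, clarsimp, intro conjI ballI)
  fix x y and u v :: real
  assume uv: "0 \<le> u" "0 \<le> v" "u + v = 1" and "x \<in> L" "y \<in> L"
  then show "u *\<^sub>R x + v *\<^sub>R y \<in> L"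
    using affine_L by (simp add: affine_def)
  fix i assume i: "i \<in> I" and "\<forall>i\<in>I. f i x \<le> b i" "\<forall>i\<in>I. f i y \<le> b i"
  then have "u * f i x + v * f i y \<le> u * b i + v * b i"
    using uv by (intro add_mono mult_left_mono) auto
  also have "\<dots> = b i" using uv by (metis mult_1 distrib_right)
  finally show "f i (u *\<^sub>R x + v *\<^sub>R y) \<le> b i" by (simp add: f_comb i)
qed

lemma affine_hull_subset_hyperplane:
  assumes "i \<in> I" "S \<subseteq> {x. f i x = c}"
  shows "affine hull S \<subseteq> {x. f i x = c}"
proof (rule hull_minimal[OF assms(2)])
  show "affine {x. f i x = c}"
    unfolding affine_def by (auto simp: f_comb assms(1) distrib_right[symmetric])
qed

text \<open>Two vertices with the same active set determine each other, so the vertices inject into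
  the subsets of \<open>I\<close>.\<close>

lemma finite_vertices: "finite vertices"
proof (rule inj_on_finite)
  show "inj_on (\<lambda>x. {i\<in>I. f i x = b i}) vertices"
    by (rule inj_onI) (auto simp: vertices_def carrier_def)
  show "(\<lambda>x. {i\<in>I. f i x = b i}) ` vertices \<subseteq> Pow I" by auto
  show "finite (Pow I)" by (simp add: finite_I)
qed

text \<open>The ratio test of the simplex method: follow the ray from \<open>x\<close> through
  \<open>y\<close> until a further inequality becomes active. Those active at \<open>x\<close> are
  active at \<open>y\<close> too and hence along the whole line.\<close>

lemma move_to_boundary:
  assumes x: "x \<in> carrier" and y: "y \<in> L"
    and tight: "\<And>i. i \<in> I \<Longrightarrow> f i x = b i \<Longrightarrow> f i y = b i"
    and ray: "\<exists>t>0. x + t *\<^sub>R (y - x) \<notin> carrier"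
  shows "\<exists>t>0. x + t *\<^sub>R (y - x) \<in> carrier \<and>
    {i\<in>I. f i (x + t *\<^sub>R (y - x)) < b i} \<subset> {i\<in>I. f i x < b i}"
proof -
  define N where "N = {i\<in>I. f i x < f i y}"
  have xL: "x \<in> L" and xb: "\<And>i. i \<in> I \<Longrightarrow> f i x \<le> b i"
    using x by (auto simp: carrier_def)
  have Nlt: "f i x < b i" if "i \<in> N" for i
    using that tight[of i] xb[of i] by (force simp: N_def)
  \<comment> \<open>If no \<open>f i\<close> increased towards \<open>y\<close>, the ray would never
    leave the polyhedron.\<close>
  have "N \<noteq> {}"
  proof
    assume "N = {}"
    then have le: "f i y \<le> f i x" if "i \<in> I" for i
      using that by (force simp: N_def)
    obtain t where t: "t > 0" "x + t *\<^sub>R (y - x) \<notin> carrier" using ray by blast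
    have "f i (x + t *\<^sub>R (y - x)) \<le> b i" if "i \<in> I" for i
      using le[OF that] xb[OF that] t(1) mult_nonneg_nonpos[of t "f i y - f i x"]
      by (simp add: f_line that)
    then show False using t(2) L_line[OF xL y] by (auto simp: carrier_def)
  qed
  have finN: "finite N" by (simp add: N_def finite_I)
  \<comment> \<open>\<open>r i\<close> is the step length at which inequality \<open>i\<close>
    becomes active; the smallest one is the longest feasible step.\<close>
  define r where "r i = (b i - f i x) / (f i y - f i x)" for i
  define t where "t = Min (r ` N)"
  have "t \<in> r ` N"
    unfolding t_def using \<open>N \<noteq> {}\<close> finN by (intro Min_in) auto
  then obtain j where j: "j \<in> N" "t = r j" by blast
  have t0: "t > 0" using j Nlt[of j] by (auto simp: r_def N_def)
  have bd: "f i (x + t *\<^sub>R (y - x)) \<le> b i" if i: "i \<in> I" for i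
  proof (cases "i \<in> N")
    case True
    then have "t \<le> r i" using finN by (simp add: t_def)
    then have "t * (f i y - f i x) \<le> b i - f i x"
      using True by (simp add: r_def N_def pos_le_divide_eq)
    then show ?thesis unfolding f_line[OF i] by linarith
  next
    case False
    then have "t * (f i y - f i x) \<le> 0"
      using t0 i by (auto simp: N_def intro!: mult_nonneg_nonpos)
    then show ?thesis using xb[OF i] by (simp add: f_line i)
  qed
  have jI: "j \<in> I" using j by (simp add: N_def)
  have "f j (x + t *\<^sub>R (y - x)) = b j"
    unfolding f_line[OF jI] j(2) r_def using j(1) by (simp add: N_def)
  moreover have "f i x < b i" if "i \<in> I" "f i (x + t *\<^sub>R (y - x)) < b i" for i
  proof (rule ccontr)
    assume "\<not> f i x < b i"
    with xb[OF that(1)] have "f i x = b i" by simp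
    with tight[OF that(1)] that show False unfolding f_line[OF that(1)] by simp
  qed
  ultimately have "{i\<in>I. f i (x + t *\<^sub>R (y - x)) < b i} \<subset> {i\<in>I. f i x < b i}"
    using Nlt[OF j(1)] jI by (intro psubsetI subsetI) (simp, metis (no_types, lifting) less_irrefl mem_Collect_eq)
  moreover have "x + t *\<^sub>R (y - x) \<in> carrier"
    using bd L_line[OF xL y] by (simp add: carrier_def)
  ultimately show ?thesis using t0 by blast
qed

text \<open>Induction on the number of inactive inequalities. A point that is not a vertex lies on a
  line that respects its active inequalities; by boundedness both directions reach points with fewer
  inactive ones, and \<open>x\<close> lies between these.\<close>

lemma carrier_eq_hull_vertices:
  assumes ray: "\<And>x y. x \<in> carrier \<Longrightarrow> y \<in> L \<Longrightarrow> y \<noteq> x \<Longrightarrow> \<exists>t>0. x + t *\<^sub>R (y - x) \<notin> carrier"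
  shows "carrier = convex hull vertices"
proof
  show "convex hull vertices \<subseteq> carrier"
    by (rule hull_minimal) (auto simp: vertices_def convex_carrier)
  have "x \<in> convex hull vertices" if "x \<in> carrier" for x
    using that
  proof (induction "card {i\<in>I. f i x < b i}" arbitrary: x rule: less_induct)
    case less
    show ?case
    proof (cases "x \<in> vertices")
      case True
      then show ?thesis by (simp add: hull_inc)
    next
      case False
      then obtain y where y: "y \<in> L" "y \<noteq> x"
        and tight: "\<And>i. i \<in> I \<Longrightarrow> f i x = b i \<Longrightarrow> f i y = b i"
        using less.prems by (auto simp: vertices_def)
      have xL: "x \<in> L" using less.prems by (simp add: carrier_def)
      \<comment> \<open>The reflection of \<open>y\<close> in \<open>x\<close> supplies the opposite
        direction.\<close>
      define y' where "y' = x + (- 1) *\<^sub>R (y - x)"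
      have y': "y' \<in> L" "y' \<noteq> x" "y' - x = - (y - x)"
        using y L_line[OF xL y(1), of "- 1"] by (auto simp: y'_def algebra_simps)
      have tight': "f i y' = b i" if "i \<in> I" "f i x = b i" for i
        unfolding y'_def f_line[OF that(1)] using tight[OF that] that(2) by simp
      have IH: "z \<in> convex hull vertices"
        if "z \<in> carrier" "{i\<in>I. f i z < b i} \<subset> {i\<in>I. f i x < b i}" for z
        using that by (intro less.hyps psubset_card_mono) (auto simp: finite_I)
      obtain t where t: "t > 0" "x + t *\<^sub>R (y - x) \<in> convex hull vertices"
        using move_to_boundary[OF less.prems y(1) tight ray[OF less.prems y]] IH by blast
      obtain s where s: "s > 0" "x + s *\<^sub>R (y' - x) \<in> convex hull vertices"
        using move_to_boundary[OF less.prems y'(1) tight' ray[OF less.prems y'(1,2)]] IH by blast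
      \<comment> \<open>This weight makes the displacements \<open>t\<close> and \<open>- s\<close>
        along \<open>y - x\<close> cancel.\<close>
      define u where "u = s / (s + t)"
      have u: "0 \<le> u" "0 \<le> 1 - u" "u * t = (1 - u) * s"
        using s t by (auto simp: u_def field_simps)
      have "u *\<^sub>R (x + t *\<^sub>R (y - x)) + (1 - u) *\<^sub>R (x + s *\<^sub>R (y' - x)) \<in> convex hull vertices"
        using s t u convex_convex_hull[of vertices] by (intro convexD) auto
      also have "u *\<^sub>R (x + t *\<^sub>R (y - x)) + (1 - u) *\<^sub>R (x + s *\<^sub>R (y' - x)) =
          x + (u * t - (1 - u) * s) *\<^sub>R (y - x)"
        unfolding y'(3) by (simp add: algebra_simps)
      also have "\<dots> = x" using u by simp
      finally show ?thesis .
    qed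
  qed
  then show "carrier \<subseteq> convex hull vertices" by (rule subsetI)
qed

text \<open>Otherwise \<open>F\<close> contains a relative interior point \<open>x\<close> of the
  polyhedron. Every segment from a point \<open>y\<close> of the polyhedron to \<open>x\<close> can
  then be prolonged beyond \<open>x\<close>, and the face property puts \<open>y\<close> into
  \<open>F\<close>.\<close>

lemma proper_face_in_hyperplane:
  assumes F: "F face_of carrier" "F \<noteq> {}" "F \<noteq> carrier"
  shows "\<exists>i\<in>I. F \<subseteq> {x. f i x = b i} \<and> \<not> carrier \<subseteq> {x. f i x = b i}"
proof (rule ccontr)
  assume neg: "\<not> ?thesis"
  \<comment> \<open>The inequalities that are not equations on the whole polyhedron.\<close>
  define J where "J = {i\<in>I. \<not> carrier \<subseteq> {x. f i x = b i}}"
  have FQ: "F \<subseteq> carrier" and cF: "convex F" using F by (auto simp: face_of_def)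
  have "finite J" by (simp add: J_def finite_I)
  have "\<exists>x\<in>F. \<forall>i\<in>J'. f i x < b i" if "finite J'" "J' \<subseteq> J" for J'
    using that
  proof (induction J' rule: finite_induct)
    case empty
    then show ?case using F by auto
  next
    case (insert j J')
    then obtain x where x: "x \<in> F" "\<forall>i\<in>J'. f i x < b i" by auto
    have jI: "j \<in> I" and "J' \<subseteq> I" using insert.prems by (auto simp: J_def)
    have "\<not> F \<subseteq> {x. f j x = b j}"
      using neg insert.prems by (auto simp: J_def)
    then obtain z where z: "z \<in> F" "f j z \<noteq> b j" by blast
    \<comment> \<open>A midpoint is strict wherever one of its two ends is, so \<open>w\<close>
      keeps the strictness of \<open>x\<close> and gains that of \<open>z\<close> at
      \<open>j\<close>.\<close>
    define w where "w = (1/2) *\<^sub>R x + (1/2) *\<^sub>R z"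
    have "w \<in> F" unfolding w_def using cF x z by (intro convexD) auto
    moreover have le: "f i x \<le> b i" "f i z \<le> b i" if "i \<in> I" for i
      using that x z FQ by (auto simp: carrier_def)
    have "f i w < b i" if "i \<in> insert j J'" for i
    proof -
      have i: "i \<in> I" using that jI \<open>J' \<subseteq> I\<close> by auto
      have "f i x < b i \<or> f i z < b i"
        using that x z le[OF i] by auto
      moreover have "f i w = 1/2 * f i x + 1/2 * f i z"
        unfolding w_def by (rule f_comb[OF i])
      ultimately show ?thesis using le[OF i] by linarith
    qed
    ultimately show ?case by blast
  qed
  from this[OF \<open>finite J\<close> subset_refl]
  obtain x where x: "x \<in> F" "\<And>i. i \<in> J \<Longrightarrow> f i x < b i" by blast
  have xQ: "x \<in> carrier" using x FQ by auto
  have "y \<in> F" if y: "y \<in> carrier" for y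
  proof (cases "y = x")
    case False
    have yL: "y \<in> L" and xL: "x \<in> L" using y xQ by (auto simp: carrier_def)
    \<comment> \<open>A common \<open>e\<close> such that a step of length \<open>e\<close> beyond
      \<open>x\<close>, away from \<open>y\<close>, violates no inequality of
      \<open>J'\<close>.\<close>
    have "\<exists>e>0. \<forall>i\<in>J'. e * (f i x - f i y) \<le> b i - f i x" if "finite J'" "J' \<subseteq> J" for J'
      using that
    proof (induction J' rule: finite_induct)
      case empty
      show ?case using zero_less_one by blast
    next
      case (insert j J')
      then obtain e where e: "e > 0" "\<forall>i\<in>J'. e * (f i x - f i y) \<le> b i - f i x" by auto
      \<comment> \<open>The \<open>+ 1\<close> keeps the denominator positive when
        \<open>f j\<close> agrees at \<open>x\<close> and \<open>y\<close>.\<close>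
      define d where "d = min e ((b j - f j x) / (\<bar>f j x - f j y\<bar> + 1))"
      have bj: "b j - f j x > 0" using x(2)[of j] insert.prems by auto
      then have d0: "d > 0" using e by (simp add: d_def)
      have "d * (f i x - f i y) \<le> b i - f i x" if "i \<in> insert j J'" for i
      proof (cases "i = j")
        case True
        have "d * (f j x - f j y) \<le> d * (\<bar>f j x - f j y\<bar> + 1)"
          using d0 by (intro mult_left_mono) auto
        also have "\<dots> \<le> (b j - f j x) / (\<bar>f j x - f j y\<bar> + 1) * (\<bar>f j x - f j y\<bar> + 1)"
          by (intro mult_right_mono) (auto simp: d_def)
        also have "\<dots> = b j - f j x"
          using abs_ge_zero[of "f j x - f j y"] by (intro nonzero_eq_divide_eq[THEN iffD1]) linarith+
        finally show ?thesis using True by simp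
      next
        case False
        then have i: "i \<in> J'" using that by simp
        show ?thesis
        proof (cases "f i x - f i y \<ge> 0")
          case True
          then have "d * (f i x - f i y) \<le> e * (f i x - f i y)"
            by (intro mult_right_mono) (auto simp: d_def)
          also have "\<dots> \<le> b i - f i x" using e i by blast
          finally show ?thesis .
        next
          case False
          then have "d * (f i x - f i y) \<le> 0" using d0 by (intro mult_nonneg_nonpos) auto
          also have "0 \<le> b i - f i x" using x(2)[of i] i insert.prems by (metis diff_ge_0_iff_ge less_imp_le insert_subset subsetD)
          finally show ?thesis .
        qed
      qed
      then show ?case using d0 by blast
    qed
    from this[OF \<open>finite J\<close> subset_refl]
    obtain e where e: "e > 0" "\<And>i. i \<in> J \<Longrightarrow> e * (f i x - f i y) \<le> b i - f i x" by blast
    define z where "z = x + (- e) *\<^sub>R (y - x)"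
    have "z \<in> carrier"
      unfolding carrier_def
    proof (intro CollectI conjI ballI)
      show "z \<in> L" unfolding z_def using L_line xL yL by blast
      fix i assume i: "i \<in> I"
      show "f i z \<le> b i"
      proof (cases "i \<in> J")
        case True
        then show ?thesis unfolding z_def f_line[OF i] using e(2)[OF True] by (simp add: right_diff_distrib)
      next
        case False
        then have "f i x = b i" "f i y = b i" using i y xQ by (auto simp: J_def)
        then show ?thesis unfolding z_def f_line[OF i] by simp
      qed
    qed
    moreover have "x \<in> open_segment y z"
    proof -
      \<comment> \<open>Solves \<open>u * e = 1 - u\<close>, which expresses \<open>x\<close> as a
        convex combination of \<open>y\<close> and \<open>z\<close>.\<close>
      define u where "u = 1 / (1 + e)"
      have u: "0 < u" "u < 1" "u * e = 1 - u" using e(1) by (auto simp: u_def field_simps)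
      have "(1 - u) *\<^sub>R y + u *\<^sub>R z = x + ((1 - u) - u * e) *\<^sub>R (y - x)"
        by (simp add: z_def algebra_simps)
      then have "x = (1 - u) *\<^sub>R y + u *\<^sub>R z" using u by simp
      moreover have "y \<noteq> z"
      proof
        assume "y = z"
        then have "y - z = 0" by simp
        moreover have "y - z = (1 + e) *\<^sub>R (y - x)" by (simp add: z_def algebra_simps)
        ultimately have "(1 + e) *\<^sub>R (y - x) = 0" by simp
        then show False using e(1) False by simp
      qed
      ultimately show ?thesis using u unfolding in_segment by blast
    qed
    ultimately show "y \<in> F" using face_ofD[OF F(1)] y x(1) by blast
  next
    case True
    then show ?thesis using x(1) by simp
  qed
  then have "carrier \<subseteq> F" by (rule subsetI)
  with FQ have "F = carrier" by (rule subset_antisym)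
  with F(3) show False ..
qed

text \<open>Moving the hyperplane into the affine part represents the face by the same inequalities,
  so that the results on faces apply again inside it.\<close>

lemma polyhedron_rep_hyperplane:
  assumes "i \<in> I"
  shows "polyhedron_rep (L \<inter> {x. f i x = b i}) I f"
    and "polyhedron_rep.carrier (L \<inter> {x. f i x = b i}) I f b = carrier \<inter> {x. f i x = b i}"
proof -
  have aff: "affine {x. f i x = b i}"
    unfolding affine_def by (auto simp: f_comb assms distrib_right[symmetric])
  interpret H: polyhedron_rep "L \<inter> {x. f i x = b i}" I f b
    using aff affine_Int[OF affine_L] finite_I linear_f by (simp add: polyhedron_rep_def)
  show "polyhedron_rep (L \<inter> {x. f i x = b i}) I f" by unfold_locales
  show "H.carrier = carrier \<inter> {x. f i x = b i}"
    by (auto simp: H.carrier_def carrier_def)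
qed

text \<open>
  A facet lies in some hyperplane \<open>f i x = b i\<close>; were it a proper face of the face that this
  hyperplane cuts out, then a second hyperplane would lower the dimension once more.
\<close>
lemma facet_eq_hyperplane_section:
  assumes poly: "polytope carrier" and F: "is_facet F carrier"
  shows "\<exists>i\<in>I. F = carrier \<inter> {x. f i x = b i}"
proof -
  obtain C where C: "finite C" "carrier = convex hull C"
    using poly by (auto simp: polytope_def)
  have sub: "T \<subseteq> affine hull C" if "T \<subseteq> carrier" for T
    using that C convex_hull_subset_affine_hull by blast
  have face: "F face_of carrier" and ne: "F \<noteq> {}"
    and dim: "affine_dimension F = affine_dimension carrier - 1"
    using F by (auto simp: is_facet_def)
  have "F \<noteq> carrier" using dim by auto
  then obtain i where i: "i \<in> I" "F \<subseteq> {x. f i x = b i}" "\<not> carrier \<subseteq> {x. f i x = b i}"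
    using proper_face_in_hyperplane[OF face ne] by blast
  interpret H: polyhedron_rep "L \<inter> {x. f i x = b i}" I f b
    using polyhedron_rep_hyperplane[OF i(1)] by simp
  have Hc: "H.carrier = carrier \<inter> {x. f i x = b i}"
    using polyhedron_rep_hyperplane[OF i(1)] by simp
  have FH: "F \<subseteq> H.carrier" using i face by (auto simp: Hc face_of_def)
  have "F = H.carrier"
  proof (rule ccontr)
    assume "F \<noteq> H.carrier"
    moreover have "F face_of H.carrier"
      by (rule face_of_subset[OF face FH]) (auto simp: Hc)
    ultimately obtain j where j: "j \<in> I" "F \<subseteq> {x. f j x = b j}" "\<not> H.carrier \<subseteq> {x. f j x = b j}"
      using H.proper_face_in_hyperplane ne by blast
    have "affine hull F \<noteq> affine hull H.carrier"
      using affine_hull_subset_hyperplane[OF j(1,2)] j(3) hull_subset[of H.carrier affine] by auto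
    then have "affine_dimension F < affine_dimension H.carrier"
      using FH sub[of H.carrier] C(1) by (intro affine_dimension_less) (auto simp: Hc)
    moreover have "affine hull H.carrier \<noteq> affine hull carrier"
      using affine_hull_subset_hyperplane[OF i(1), of H.carrier "b i"] i(3)
        hull_subset[of carrier affine] by (auto simp: Hc)
    then have "affine_dimension H.carrier < affine_dimension carrier"
      using sub[of carrier] C(1) by (intro affine_dimension_less) (auto simp: Hc)
    ultimately show False using dim by simp
  qed
  then show ?thesis using i Hc by auto
qed

lemma num_facets_le:
  assumes "polytope carrier"
  shows "num_facets carrier \<le> card I"
proof -
  have "{F. is_facet F carrier} \<subseteq> (\<lambda>i. carrier \<inter> {x. f i x = b i}) ` I"
    using facet_eq_hyperplane_section[OF assms] by auto
  then show ?thesis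
    unfolding num_facets_def using finite_I by (meson card_image_le card_mono finite_imageI le_trans)
qed

end

subsection \<open>Coordinates\<close>

lemma lookup_scaleR [simp]: "Poly_Mapping.lookup (r *\<^sub>R x) i = r *\<^sub>R Poly_Mapping.lookup x i"
  for x :: "'i \<Rightarrow>\<^sub>0 'b::real_vector"
proof -
  have "finite {i. r *\<^sub>R Poly_Mapping.lookup x i \<noteq> 0}"
    by (rule finite_subset[OF _ finite_lookup[of x]]) auto
  then show ?thesis by (simp add: scaleR_poly_mapping_def)
qed

lemma coord_space_iff: "x \<in> coord_space I \<longleftrightarrow> (\<forall>i. i \<notin> I \<longrightarrow> Poly_Mapping.lookup x i = 0)"
  by (auto simp: coord_space_def in_keys_iff)

lemma lookup_sum_single:
  assumes "finite I"
  shows "Poly_Mapping.lookup (\<Sum>i\<in>I. Poly_Mapping.single i (v i)) j = (if j \<in> I then v j else 0)"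
  using assms by (simp add: lookup_sum lookup_single when_def)

lemma leave_bounded_coordinates:
  fixes x y :: "'i \<Rightarrow>\<^sub>0 real"
  assumes bounded: "\<And>z i. z \<in> S \<Longrightarrow> \<bar>Poly_Mapping.lookup z i\<bar> \<le> 1" and "x \<in> S" "y \<noteq> x"
  shows "\<exists>t>0. x + t *\<^sub>R (y - x) \<notin> S"
proof -
  obtain i where i: "Poly_Mapping.lookup y i \<noteq> Poly_Mapping.lookup x i"
    using \<open>y \<noteq> x\<close> poly_mapping_eqI[of y x] by auto
  define \<delta> where "\<delta> = Poly_Mapping.lookup y i - Poly_Mapping.lookup x i"
  have \<delta>: "\<delta> \<noteq> 0" using i by (simp add: \<delta>_def)
  \<comment> \<open>The step length moves coordinate \<open>i\<close> by exactly 3, more than the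
    width 2 of the interval from -1 to 1.\<close>
  have "Poly_Mapping.lookup (x + (3 / \<bar>\<delta>\<bar>) *\<^sub>R (y - x)) i = Poly_Mapping.lookup x i + 3 * sgn \<delta>"
    by (simp add: lookup_add lookup_minus \<delta>_def[symmetric] sgn_if \<delta>)
  moreover have "\<bar>3 * sgn \<delta>\<bar> = 3" using \<delta> by (simp add: sgn_if)
  ultimately have "x + (3 / \<bar>\<delta>\<bar>) *\<^sub>R (y - x) \<notin> S"
    using bounded[of "x + (3 / \<bar>\<delta>\<bar>) *\<^sub>R (y - x)" i] bounded[OF \<open>x \<in> S\<close>, of i] by fastforce
  then show ?thesis using \<delta> by (intro exI[of _ "3 / \<bar>\<delta>\<bar>"]) simp
qed

subsection \<open>Orientations\<close>

definition induced :: "'v set set \<Rightarrow> 'v set \<Rightarrow> 'v set set" where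
  "induced E U = {e \<in> E. e \<subseteq> U}"

lemma finite_induced [simp]: "finite E \<Longrightarrow> finite (induced E U)"
  by (simp add: induced_def)

text \<open>Edges inside both sets are those inside \<open>U \<inter> W\<close>; the only surplus on
  the right comes from edges joining \<open>U - W\<close> to \<open>W - U\<close>. Both integer edge
  counts and real weights are instances.\<close>

lemma sum_induced_supermodular:
  fixes x :: "'v set \<Rightarrow> 'b::linordered_idom"
  assumes "finite E" "\<And>e. e \<in> E \<Longrightarrow> 0 \<le> x e"
  shows "sum x (induced E U) + sum x (induced E W) \<le>
    sum x (induced E (U \<union> W)) + sum x (induced E (U \<inter> W))"
proof -
  have "sum x (induced E U) + sum x (induced E W) =
      sum x (induced E U \<union> induced E W) + sum x (induced E U \<inter> induced E W)"
    using assms(1) by (simp add: sum.union_inter)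
  also have "induced E U \<inter> induced E W = induced E (U \<inter> W)"
    by (auto simp: induced_def)
  also have "sum x (induced E U \<union> induced E W) \<le> sum x (induced E (U \<union> W))"
    using assms by (intro sum_mono2) (auto simp: induced_def)
  finally show ?thesis by simp
qed

text \<open>
  Orient one edge \<open>{a, b}\<close> at a time. If neither end can be chosen, there are saturated sets
  \<open>U\<close> and \<open>W\<close> containing only \<open>a\<close> and only \<open>b\<close>, respectively; uncrossing them leaves no room
  for the edge inside \<open>U \<union> W\<close>.
\<close>
lemma orientation_exists:
  fixes c :: "'v \<Rightarrow> int"
  assumes "finite V" "finite F" "\<And>e. e \<in> F \<Longrightarrow> e \<subseteq> V \<and> card e = 2"
    and "\<And>U. U \<subseteq> V \<Longrightarrow> int (card (induced F U)) \<le> sum c U"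
  shows "\<exists>h. (\<forall>e\<in>F. h e \<in> e) \<and> (\<forall>w\<in>V. int (card {e\<in>F. h e = w}) \<le> c w)"
  using assms(2-)
proof (induction F arbitrary: c rule: finite_induct)
  case empty
  have "0 \<le> c w" if "w \<in> V" for w
    using empty(2)[of "{w}"] that by (simp add: induced_def)
  then show ?case by simp
next
  case (insert e F)
  obtain a b where e: "e = {a, b}" "a \<noteq> b" using insert.prems(1)[of e] by (auto simp: card_2_iff)
  have ab: "a \<in> V" "b \<in> V" using insert.prems(1)[of e] e by auto
  \<comment> \<open>\<open>d v\<close> is the capacity left once \<open>e\<close> is directed to
    \<open>v\<close>; \<open>good v\<close> says that the counting condition survives for the
    remaining edges.\<close>
  define d where "d v = c(v := c v - 1)" for v
  define good where "good v \<longleftrightarrow> (\<forall>U\<subseteq>V. int (card (induced F U)) \<le> sum (d v) U)" for v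
  have sum_d: "sum (d v) U = sum c U - (if v \<in> U then 1 else 0)" if "U \<subseteq> V" for v U
  proof -
    have "finite U" using that assms(1) finite_subset by blast
    then have "sum (d v) U = (\<Sum>u\<in>U. c u - (if u = v then 1 else 0))"
      by (intro sum.cong) (auto simp: d_def)
    then show ?thesis using \<open>finite U\<close> by (simp add: sum_subtractf)
  qed
  have ins: "card (induced (insert e F) U) = card (induced F U) + (if e \<subseteq> U then 1 else 0)" for U
  proof -
    have "induced (insert e F) U = (if e \<subseteq> U then insert e (induced F U) else induced F U)"
      by (auto simp: induced_def)
    then show ?thesis using insert.hyps by (auto simp: induced_def)
  qed
  have step: ?case if v: "v \<in> e" and g: "good v" for v
  proof -
    obtain h where h: "\<forall>e\<in>F. h e \<in> e"
      "\<forall>w\<in>V. int (card {e\<in>F. h e = w}) \<le> d v w"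
      using insert.IH[of "d v", OF insert.prems(1)[OF insertI2]] g[unfolded good_def]
      by blast
    have indeg: "{e' \<in> insert e F. (h(e := v)) e' = w} =
        (if w = v then insert e {e'\<in>F. h e' = w} else {e'\<in>F. h e' = w})" for w
      using insert.hyps by auto
    have "int (card {e' \<in> insert e F. (h(e := v)) e' = w}) \<le> c w" if "w \<in> V" for w
      unfolding indeg using bspec[OF h(2) that] insert.hyps by (simp add: d_def split: if_splits)
    moreover have "\<forall>e'\<in>insert e F. (h(e := v)) e' \<in> e'" using h(1) v by simp
    ultimately show ?thesis by blast
  qed
  have "good a \<or> good b"
  proof (rule ccontr)
    have saturated: "\<exists>U\<subseteq>V. v \<in> U \<and> \<not> e \<subseteq> U \<and> sum c U \<le> int (card (induced F U))"
      if bad: "\<not> good v" for v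
    proof -
      obtain U where U: "U \<subseteq> V" "\<not> int (card (induced F U)) \<le> sum (d v) U"
        using bad unfolding good_def by blast
      \<comment> \<open>The condition held for \<open>insert e F\<close> with \<open>c\<close> and
        lowering \<open>c v\<close> by one breaks it for \<open>F\<close>, so by integrality it was
        an equality and \<open>e\<close> is not inside \<open>U\<close>.\<close>
      have "v \<in> U" "\<not> e \<subseteq> U" "sum c U \<le> int (card (induced F U))"
        using insert.prems(2)[OF U(1)] U(2) unfolding ins sum_d[OF U(1)] by (auto split: if_splits)
      then show ?thesis using U(1) by blast
    qed
    assume "\<not> (good a \<or> good b)"
    then have bad: "\<not> good a" "\<not> good b" by blast+
    obtain U where U: "U \<subseteq> V" "a \<in> U" "\<not> e \<subseteq> U" "sum c U \<le> int (card (induced F U))"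
      using saturated[OF bad(1)] by blast
    obtain W where W: "W \<subseteq> V" "b \<in> W" "\<not> e \<subseteq> W" "sum c W \<le> int (card (induced F W))"
      using saturated[OF bad(2)] by blast
    have "e \<subseteq> U \<union> W" using U(2) W(2) e by blast
    then have "int (card (induced F (U \<union> W))) + 1 \<le> sum c (U \<union> W)"
      using insert.prems(2)[of "U \<union> W"] U(1) W(1) unfolding ins by simp
    moreover have "int (card (induced F (U \<inter> W))) \<le> sum c (U \<inter> W)"
      using insert.prems(2)[of "U \<inter> W"] U(1) unfolding ins by fastforce
    moreover have "sum c (U \<union> W) + sum c (U \<inter> W) = sum c U + sum c W"
      using U(1) W(1) assms(1) by (intro sum.union_inter) (auto intro: finite_subset)
    moreover have "int (card (induced F U)) + int (card (induced F W)) \<le>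
        int (card (induced F (U \<union> W))) + int (card (induced F (U \<inter> W)))"
      using sum_induced_supermodular[of F "\<lambda>_. 1 :: int" U W] insert.hyps by simp
    ultimately show False using U(4) W(4) by linarith
  qed
  then show ?case using step e by blast
qed

lemma lookup_incidence_vector:
  "finite F \<Longrightarrow> Poly_Mapping.lookup (incidence_vector F) e = (if e \<in> F then 1 else 0)"
  unfolding incidence_vector_def by (rule lookup_sum_single)

subsection \<open>Integrality of the count polytope\<close>

text \<open>Labels for the three kinds of inequalities, which gives \<open>polyhedron_rep\<close> a
  single index set.\<close>

datatype 'v row = Nonneg "'v set" | At_Most_One "'v set" | Count "'v set"

locale count_graph =
  fixes k l :: int and V :: "'v set" and E :: "'v set set"
  assumes k_le_l: "k \<le> l" and l_le: "l \<le> 2 * k - 1" and graph: "simple_graph V E"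
begin

lemma finite_V: "finite V" and edgeD: "e \<in> E \<Longrightarrow> e \<subseteq> V \<and> card e = 2"
  using graph by (auto simp: simple_graph_def)

lemma finite_E: "finite E"
  using finite_V edgeD by (meson Pow_iff finite_Pow_iff finite_subset subsetI)

lemma k_pos: "0 < k"
  using k_le_l l_le by linarith

lemma finite_subV: "U \<subseteq> V \<Longrightarrow> finite U"
  using finite_V finite_subset by blast

text \<open>By \<open>l \<le> 2 * k - 1\<close>, the maximum with 0 in \<open>sparse\<close> and
  \<open>tight\<close> is its first argument as soon as there are two vertices.\<close>

lemma count_pos: "2 \<le> card U \<Longrightarrow> 0 < k * int (card U) - l"
proof -
  assume "2 \<le> card U"
  then have "k * 2 \<le> k * int (card U)" using k_pos by (intro mult_left_mono) auto
  then show ?thesis using l_le by linarith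
qed

text \<open>Among the edge sets living on \<open>U\<close> the induced one is largest, so the
  condition over edge sets becomes one over vertex sets.\<close>

lemma sparse_iff:
  assumes "F \<subseteq> E"
  shows "sparse k l F \<longleftrightarrow>
    (\<forall>U\<subseteq>V. 2 \<le> card U \<longrightarrow> int (card (induced F U)) \<le> k * int (card U) - l)"
proof (intro iffI allI impI)
  fix U assume sp: "sparse k l F" and U: "U \<subseteq> V" "2 \<le> card U"
  have "induced F U \<subseteq> F" by (auto simp: induced_def)
  then have "int (card (induced F U)) \<le> max (k * int (card (\<Union>(induced F U))) - l) 0"
    using sp by (simp add: sparse_def)
  moreover have "card (\<Union>(induced F U)) \<le> card U"
    using finite_subV[OF U(1)] by (intro card_mono) (auto simp: induced_def)
  then have "k * int (card (\<Union>(induced F U))) \<le> k * int (card U)"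
    using k_pos by (intro mult_left_mono) auto
  ultimately show "int (card (induced F U)) \<le> k * int (card U) - l"
    using count_pos[OF U(2)] by linarith
next
  assume *: "\<forall>U\<subseteq>V. 2 \<le> card U \<longrightarrow> int (card (induced F U)) \<le> k * int (card U) - l"
  have "int (card F') \<le> max (k * int (card (\<Union>F')) - l) 0" if F': "F' \<subseteq> F" for F'
  proof (cases "F' = {}")
    case False
    then obtain e where e: "e \<in> F'" by blast
    have V: "\<Union>F' \<subseteq> V" using F' assms edgeD by blast
    have "card e \<le> card (\<Union>F')"
      using e finite_subV[OF V] by (intro card_mono) auto
    then have "2 \<le> card (\<Union>F')" using edgeD e F' assms by (metis subsetD)
    then have "int (card (induced F (\<Union>F'))) \<le> k * int (card (\<Union>F')) - l"
      using * V by blast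
    moreover have "card F' \<le> card (induced F (\<Union>F'))"
      using F' assms finite_E by (intro card_mono finite_induced) (auto simp: induced_def intro: finite_subset)
    ultimately show ?thesis by linarith
  qed auto
  then show "sparse k l F" by (simp add: sparse_def)
qed

abbreviation x_sum :: "('v set \<Rightarrow>\<^sub>0 real) \<Rightarrow> 'v set set \<Rightarrow> real" where
  "x_sum x F \<equiv> sum (Poly_Mapping.lookup x) F"

definition base_space :: "('v set \<Rightarrow>\<^sub>0 real) set" where
  "base_space = {x \<in> coord_space E. x_sum x E = real_of_int (k * int (card V) - l)}"

definition rows :: "'v row set" where
  "rows = Nonneg ` E \<union> At_Most_One ` E \<union> Count ` {U. U \<subseteq> V \<and> 2 \<le> card U}"

definition row_val :: "'v row \<Rightarrow> ('v set \<Rightarrow>\<^sub>0 real) \<Rightarrow> real" where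
  "row_val r x = (case r of Nonneg e \<Rightarrow> - Poly_Mapping.lookup x e
    | At_Most_One e \<Rightarrow> Poly_Mapping.lookup x e | Count U \<Rightarrow> x_sum x (induced E U))"

definition row_bound :: "'v row \<Rightarrow> real" where
  "row_bound r = (case r of Nonneg e \<Rightarrow> 0 | At_Most_One e \<Rightarrow> 1
    | Count U \<Rightarrow> real_of_int (k * int (card U) - l))"

lemma polyhedron_rep_base: "polyhedron_rep base_space rows row_val"
  unfolding polyhedron_rep_def
proof (intro conjI allI impI)
  show "affine base_space"
    by (auto simp: affine_def base_space_def coord_space_iff lookup_add sum.distrib
        simp flip: sum_distrib_left distrib_right)
  show "finite rows"
    using finite_E finite_V by (simp add: rows_def)
  show "linear (row_val r)" for r
    by (rule linearI)
      (auto simp: row_val_def lookup_add sum.distrib sum_distrib_left split: row.splits)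
qed

sublocale base: polyhedron_rep base_space rows row_val row_bound
  by (rule polyhedron_rep_base)

lemma base_carrier_iff:
  "x \<in> base.carrier \<longleftrightarrow> x \<in> coord_space E \<and> x_sum x E = real_of_int (k * int (card V) - l) \<and>
    (\<forall>e\<in>E. 0 \<le> Poly_Mapping.lookup x e \<and> Poly_Mapping.lookup x e \<le> 1) \<and>
    (\<forall>U. U \<subseteq> V \<and> 2 \<le> card U \<longrightarrow> x_sum x (induced E U) \<le> real_of_int (k * int (card U) - l))"
  unfolding base.carrier_def
  by (auto simp: base_space_def rows_def row_val_def row_bound_def ball_Un)

text \<open>
  Among the tight vertex sets spanning a fractional edge take one, \<open>U\<close>, of least cardinality.
  It spans two fractional edges, and by uncrossing a tight set spans both or neither of them.
  So weight can be shifted between the two without leaving the minimal face.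
\<close>
lemma base_vertex_integral:
  assumes x: "x \<in> base.vertices" and V2: "2 \<le> card V" and e0: "e0 \<in> E"
  shows "Poly_Mapping.lookup x e0 = 0 \<or> Poly_Mapping.lookup x e0 = 1"
proof (rule ccontr)
  have xc: "x \<in> base.carrier" using x by (simp add: base.vertices_def)
  have bnd: "0 \<le> Poly_Mapping.lookup x e" "Poly_Mapping.lookup x e \<le> 1" if "e \<in> E" for e
    using xc that by (auto simp: base_carrier_iff)
  define frac where "frac e \<longleftrightarrow> Poly_Mapping.lookup x e \<notin> \<int>" for e
  define tight_set where "tight_set U \<longleftrightarrow> U \<subseteq> V \<and> 2 \<le> card U \<and>
      x_sum x (induced E U) = real_of_int (k * int (card U) - l)" for U
  assume "\<not> (Poly_Mapping.lookup x e0 = 0 \<or> Poly_Mapping.lookup x e0 = 1)"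
  then have "Poly_Mapping.lookup x e0 \<noteq> 0" "Poly_Mapping.lookup x e0 \<noteq> 1" by auto
  with bnd[OF e0] have "0 < Poly_Mapping.lookup x e0" "Poly_Mapping.lookup x e0 < 1" by linarith+
  then have "frac e0" unfolding frac_def by (auto elim!: Ints_cases)
  \<comment> \<open>The equation in \<open>base_space\<close> makes \<open>V\<close> itself tight,
    so a least tight set spanning a fractional edge exists.\<close>
  moreover have "induced E V = E" using edgeD by (auto simp: induced_def)
  ultimately have "\<exists>e\<in>induced E V. frac e" "tight_set V"
    using xc V2 e0 by (auto simp: tight_set_def base_carrier_iff)
  then obtain U where U: "tight_set U" "\<exists>e\<in>induced E U. frac e"
    and least: "\<And>W. tight_set W \<and> (\<exists>e\<in>induced E W. frac e) \<Longrightarrow> card U \<le> card W"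
    using ex_has_least_nat[of "\<lambda>U. tight_set U \<and> (\<exists>e\<in>induced E U. frac e)" V card] by blast
  then obtain e where e: "e \<in> induced E U" "frac e" by blast
  \<comment> \<open>The weight inside the tight set \<open>U\<close> is an integer, so
    \<open>e\<close> cannot be its only fractional edge.\<close>
  obtain e' where e': "e' \<in> induced E U" "frac e'" "e' \<noteq> e"
  proof -
    have "x_sum x (induced E U) = Poly_Mapping.lookup x e + x_sum x (induced E U - {e})"
      using e finite_E by (simp add: sum.remove)
    then have eq: "Poly_Mapping.lookup x e =
        real_of_int (k * int (card U) - l) - x_sum x (induced E U - {e})"
      using U by (simp add: tight_set_def)
    have "\<exists>e'\<in>induced E U - {e}. frac e'"
    proof (rule ccontr)
      assume "\<not> ?thesis"
      then have "x_sum x (induced E U - {e}) \<in> \<int>"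
        by (intro Ints_sum) (simp add: frac_def)
      then have "Poly_Mapping.lookup x e \<in> \<int>"
        unfolding eq by (intro Ints_diff Ints_of_int)
      with e(2) show False by (simp add: frac_def)
    qed
    then show ?thesis using that by blast
  qed
  \<comment> \<open>The shared edge \<open>d\<close> gives \<open>U \<inter> W\<close> two vertices,
    so the count inequality holds there; supermodularity makes \<open>U \<inter> W\<close> tight,
    and minimality of \<open>U\<close> yields \<open>U \<inter> W = U\<close>.\<close>
  have spans: "U \<subseteq> W" if W: "tight_set W" and d: "d \<in> induced E U" "frac d" "d \<in> induced E W" for W d
  proof -
    have dUW: "d \<in> induced E (U \<inter> W)" using d by (auto simp: induced_def)
    have U': "U \<subseteq> V" "2 \<le> card U" and W': "W \<subseteq> V"
      using U W by (auto simp: tight_set_def)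
    have "card d \<le> card (U \<inter> W)"
      using dUW U' finite_subV by (intro card_mono) (auto simp: induced_def)
    then have c1: "2 \<le> card (U \<inter> W)" using dUW edgeD by (auto simp: induced_def)
    moreover have "card U \<le> card (U \<union> W)"
      using U' W' finite_subV by (intro card_mono) auto
    ultimately have "2 \<le> card (U \<union> W)" using U' by simp
    have count: "x_sum x (induced E X) \<le> real_of_int (k * int (card X) - l)"
      if "X \<subseteq> V" "2 \<le> card X" for X
      using xc that by (simp add: base_carrier_iff)
    have le: "x_sum x (induced E (U \<inter> W)) \<le> real_of_int (k * int (card (U \<inter> W)) - l)"
      "x_sum x (induced E (U \<union> W)) \<le> real_of_int (k * int (card (U \<union> W)) - l)"
      using U'(1) W' by (intro count c1 \<open>2 \<le> card (U \<union> W)\<close>; blast)+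
    have "int (card (U \<union> W)) + int (card (U \<inter> W)) = int (card U) + int (card W)"
      using card_Un_Int[of U W] finite_subV U' W' by simp
    then have "k * int (card (U \<union> W)) + k * int (card (U \<inter> W)) = k * int (card U) + k * int (card W)"
      by (metis distrib_left)
    moreover have "x_sum x (induced E U) + x_sum x (induced E W) \<le>
        x_sum x (induced E (U \<union> W)) + x_sum x (induced E (U \<inter> W))"
      using bnd finite_E by (intro sum_induced_supermodular) auto
    ultimately have "real_of_int (k * int (card (U \<inter> W)) - l) \<le> x_sum x (induced E (U \<inter> W))"
      using U W le unfolding tight_set_def by linarith
    then have "tight_set (U \<inter> W)"
      using le(1) c1 U' by (auto simp: tight_set_def)
    then have "card U \<le> card (U \<inter> W)" using least dUW d(2) by blast
    then have "U \<inter> W = U" using finite_subV[OF U'(1)] by (intro card_seteq) auto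
    then show ?thesis by blast
  qed
  have same: "e \<in> induced E W \<longleftrightarrow> e' \<in> induced E W" if "tight_set W" for W
    using spans[OF that e(1,2)] spans[OF that e'(1,2)] e e' by (auto simp: induced_def)
  \<comment> \<open>A whole unit may be shifted although \<open>y\<close> can leave
    \<open>base.carrier\<close>: \<open>base.vertices\<close> only asks that active rows stay
    equalities.\<close>
  define y where "y = x + (Poly_Mapping.single e 1 - Poly_Mapping.single e' 1)"
  have y: "Poly_Mapping.lookup y = (\<lambda>j. Poly_Mapping.lookup x j + ((if e = j then 1 else 0) - (if e' = j then 1 else 0)))"
    by (auto simp: y_def lookup_add lookup_minus lookup_single when_def)
  have E: "e \<in> E" "e' \<in> E" using e e' by (auto simp: induced_def)
  have y_sum: "x_sum y A = x_sum x A + ((if e \<in> A then 1 else 0) - (if e' \<in> A then 1 else 0))"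
    if "finite A" for A
    using that by (simp add: y sum.distrib sum_subtractf)
  have "y \<in> base_space"
  proof -
    have "Poly_Mapping.lookup x i = 0" if "i \<notin> E" for i
      using xc that by (simp add: base_carrier_iff coord_space_iff)
    then have "y \<in> coord_space E" using E by (auto simp: coord_space_iff y)
    moreover have "x_sum y E = real_of_int (k * int (card V) - l)"
      using xc E finite_E by (simp add: y_sum base_carrier_iff)
    ultimately show ?thesis by (simp add: base_space_def)
  qed
  moreover have "row_val r y = row_bound r" if r: "r \<in> rows" "row_val r x = row_bound r" for r
  proof (cases r)
    case (Nonneg d)
    then have "\<not> frac d" using r by (simp add: row_val_def row_bound_def frac_def)
    then have "e \<noteq> d" "e' \<noteq> d" using e e' by auto
    then show ?thesis using r Nonneg by (simp add: row_val_def row_bound_def y)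
  next
    case (At_Most_One d)
    then have "\<not> frac d" using r by (simp add: row_val_def row_bound_def frac_def)
    then have "e \<noteq> d" "e' \<noteq> d" using e e' by auto
    then show ?thesis using r At_Most_One by (simp add: row_val_def row_bound_def y)
  next
    case (Count W)
    then have "tight_set W"
      using r by (auto simp: row_val_def row_bound_def rows_def tight_set_def)
    then show ?thesis
      using same[of W] r Count finite_E by (simp add: row_val_def row_bound_def y_sum)
  qed
  ultimately have "y = x" using x by (auto simp: base.vertices_def)
  then have "Poly_Mapping.lookup y e = Poly_Mapping.lookup x e" by simp
  then show False using e'(3) by (simp add: y)
qed

lemma base_vertex_tight:
  assumes x: "x \<in> base.vertices" and V2: "2 \<le> card V"
  shows "\<exists>F\<subseteq>E. tight k l V F \<and> x = incidence_vector F"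
proof (intro exI conjI)
  define F where "F = {e\<in>E. Poly_Mapping.lookup x e = 1}"
  have xc: "x \<in> base.carrier" using x by (simp add: base.vertices_def)
  show "F \<subseteq> E" by (auto simp: F_def)
  have finF: "finite F" using finite_E by (simp add: F_def)
  have x_F: "Poly_Mapping.lookup x e = (if e \<in> F then 1 else 0)" if "e \<in> E" for e
    using base_vertex_integral[OF x V2 that] that by (auto simp: F_def)
  have card_F: "x_sum x A = real (card (A \<inter> F))" if "A \<subseteq> E" for A
  proof -
    have "x_sum x A = (\<Sum>e\<in>A. if e \<in> F then 1 else 0)"
      using that by (intro sum.cong) (auto simp: x_F)
    moreover have "finite A" using that finite_E by (rule finite_subset)
    ultimately show ?thesis by (simp flip: sum.inter_restrict)
  qed
  show "x = incidence_vector F"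
  proof (rule poly_mapping_eqI)
    fix e show "Poly_Mapping.lookup x e = Poly_Mapping.lookup (incidence_vector F) e"
    proof (cases "e \<in> E")
      case True
      then show ?thesis by (simp add: lookup_incidence_vector finF x_F)
    next
      case False
      then have "Poly_Mapping.lookup x e = 0" "e \<notin> F"
        using xc by (auto simp: base_carrier_iff coord_space_iff F_def)
      then show ?thesis by (simp add: lookup_incidence_vector finF)
    qed
  qed
  have "int (card (induced F U)) \<le> k * int (card U) - l" if "U \<subseteq> V" "2 \<le> card U" for U
  proof -
    have "induced E U \<inter> F = induced F U" by (auto simp: induced_def F_def)
    then have "real (card (induced F U)) \<le> real_of_int (k * int (card U) - l)"
      using xc that card_F[of "induced E U"] by (auto simp: base_carrier_iff induced_def)
    then show ?thesis by linarith
  qed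
  then have "sparse k l F" using sparse_iff[OF \<open>F \<subseteq> E\<close>] by blast
  moreover have "real_of_int (int (card F)) = real_of_int (k * int (card V) - l)"
    using xc card_F[of E] \<open>F \<subseteq> E\<close> by (simp add: base_carrier_iff Int_absorb1)
  then have "int (card F) = k * int (card V) - l" by (simp only: of_int_eq_iff)
  ultimately show "tight k l V F"
    using count_pos[OF V2] by (simp add: tight_def)
qed

lemma coordinates_base_carrier:
  assumes "x \<in> base.carrier"
  shows "\<bar>Poly_Mapping.lookup x e\<bar> \<le> 1"
proof (cases "e \<in> E")
  case True
  then show ?thesis using assms by (simp add: base_carrier_iff)
next
  case False
  then show ?thesis using assms by (simp add: base_carrier_iff coord_space_iff)
qed

lemma base_carrier_subset:
  assumes "2 \<le> card V"
  shows "base.carrier \<subseteq> tight_polytope k l V E"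
proof -
  have "base.carrier = convex hull base.vertices"
  proof (rule base.carrier_eq_hull_vertices)
    fix x y
    assume "x \<in> base.carrier" "y \<noteq> x"
    then show "\<exists>t>0. x + t *\<^sub>R (y - x) \<notin> base.carrier"
      by (rule leave_bounded_coordinates[where S = base.carrier, rotated]) (rule coordinates_base_carrier)
  qed
  also have "\<dots> \<subseteq> tight_polytope k l V E"
    unfolding tight_polytope_def
  proof (rule hull_mono, rule subsetI)
    fix x assume "x \<in> base.vertices"
    then show "x \<in> {incidence_vector F |F. F \<subseteq> E \<and> tight k l V F}"
      using base_vertex_tight[OF _ assms] by auto
  qed
  finally show ?thesis .
qed

subsection \<open>The extended formulation\<close>

definition pairs :: "('v \<times> 'v) set" where
  "pairs = {(u, v). u \<in> V \<and> v \<in> V \<and> u \<noteq> v}"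

text \<open>Relative to \<open>k\<close> everywhere, the deficits are \<open>k\<close> and
  \<open>l - k\<close>. They are nonnegative by \<open>k \<le> l\<close> and add up to
  \<open>l\<close>, so a set loses at most \<open>l\<close>, and exactly \<open>l\<close> when it
  contains both vertices.\<close>

definition cap :: "'v \<times> 'v \<Rightarrow> 'v \<Rightarrow> int" where
  "cap d w = (if w = fst d then 0 else if w = snd d then 2 * k - l else k)"

lemma finite_pairs: "finite pairs"
  by (rule finite_subset[of _ "V \<times> V"]) (auto simp: pairs_def finite_V)

lemma sum_cap:
  assumes "d \<in> pairs" "finite U"
  shows "sum (cap d) U = k * int (card U) - (if fst d \<in> U then k else 0) - (if snd d \<in> U then l - k else 0)"
proof -
  have "sum (cap d) U = (\<Sum>w\<in>U. k - (if fst d = w then k else 0) - (if snd d = w then l - k else 0))"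
    using assms(1) by (intro sum.cong) (auto simp: cap_def pairs_def)
  then show ?thesis using assms(2) by (simp add: sum_subtractf)
qed

lemma card_V_of_pair: "d \<in> pairs \<Longrightarrow> 2 \<le> card V"
proof -
  assume "d \<in> pairs"
  then have "{fst d, snd d} \<subseteq> V" "card {fst d, snd d} = 2" by (auto simp: pairs_def)
  then show ?thesis using finite_V by (metis card_mono)
qed

text \<open>Sparsity supplies the counting condition of \<open>orientation_exists\<close> for
  \<open>cap d\<close>. Tightness makes the total capacity equal to \<open>card F\<close>, which
  turns all upper bounds on in-degrees into equalities.\<close>

lemma tight_orientation:
  assumes F: "F \<subseteq> E" "tight k l V F" and d: "d \<in> pairs"
  shows "\<exists>h. (\<forall>e\<in>F. h e \<in> e) \<and> (\<forall>w\<in>V. int (card {e\<in>F. h e = w}) = cap d w)"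
proof -
  have finF: "finite F" using F(1) finite_E by (rule finite_subset)
  have edge: "e \<subseteq> V \<and> card e = 2" if "e \<in> F" for e using F(1) edgeD that by blast
  have "int (card (induced F U)) \<le> sum (cap d) U" if U: "U \<subseteq> V" for U
  proof (cases "2 \<le> card U")
    case True
    have "int (card (induced F U)) \<le> k * int (card U) - l"
      using F sparse_iff[OF F(1)] U True by (auto simp: tight_def)
    also have "\<dots> \<le> sum (cap d) U"
      using k_le_l k_pos sum_cap[OF d finite_subV[OF U]] by simp
    finally show ?thesis .
  next
    case False
    \<comment> \<open>With fewer than two vertices \<open>U\<close> spans no edge, so nonnegative
      capacities suffice.\<close>
    have "\<not> e \<subseteq> U" if "e \<in> F" for e
      using card_mono[OF finite_subV[OF U], of e] edge[OF that] False by linarith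
    then have "induced F U = {}" by (auto simp: induced_def)
    moreover have "0 \<le> sum (cap d) U"
      using k_pos l_le by (intro sum_nonneg) (auto simp: cap_def)
    ultimately show ?thesis by simp
  qed
  from orientation_exists[OF finite_V finF edge this]
  obtain h where h: "\<forall>e\<in>F. h e \<in> e" and le: "\<forall>w\<in>V. int (card {e\<in>F. h e = w}) \<le> cap d w"
    by blast
  \<comment> \<open>Every edge is counted once, at its head.\<close>
  have "card F = (\<Sum>w\<in>V. card {e\<in>F. h e = w})"
    using h edge finF finite_V sum.group[of F V h "\<lambda>_. 1 :: nat"] by fastforce
  then have "(\<Sum>w\<in>V. int (card {e\<in>F. h e = w})) = int (card F)" by simp
  also have "\<dots> = k * int (card V) - l"
    using F(2) count_pos[OF card_V_of_pair[OF d]] by (simp add: tight_def)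
  also have "\<dots> = sum (cap d) V"
    using d sum_cap[OF d finite_V] by (auto simp: pairs_def)
  finally have eq: "(\<Sum>w\<in>V. int (card {e\<in>F. h e = w})) = sum (cap d) V" .
  have "int (card {e\<in>F. h e = w}) = cap d w" if "w \<in> V" for w
    by (rule sum_mono_inv[OF eq _ that finite_V]) (use le in blast)
  with h show ?thesis by blast
qed

text \<open>
  The variable \<open>Inl e\<close> is the weight of the edge \<open>e\<close>; \<open>Inr (d, e, w)\<close> is the part of it that is
  directed to the end \<open>w\<close> in the fractional orientation belonging to the pair \<open>d\<close>.
\<close>
definition vars :: "('v set + ('v \<times> 'v) \<times> 'v set \<times> 'v) set" where
  "vars = E <+> pairs \<times> (SIGMA e:E. e)"

lemma Inl_in_vars [simp]: "Inl e \<in> vars \<longleftrightarrow> e \<in> E"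
  and Inr_in_vars [simp]: "Inr (d, e, w) \<in> vars \<longleftrightarrow> d \<in> pairs \<and> e \<in> E \<and> w \<in> e"
  by (auto simp: vars_def)

text \<open>Numbers the variables, because \<open>extended_formulation\<close> places
  \<open>Q\<close> in \<open>coord_space {..<p}\<close>; \<open>coord\<close> hides the numbering
  again.\<close>

definition enum :: "'v set + ('v \<times> 'v) \<times> 'v set \<times> 'v \<Rightarrow> nat" where
  "enum = (SOME g. bij_betw g vars {..<card vars})"

definition coord :: "(nat \<Rightarrow>\<^sub>0 real) \<Rightarrow> 'v set + ('v \<times> 'v) \<times> 'v set \<times> 'v \<Rightarrow> real" where
  "coord z j = Poly_Mapping.lookup z (enum j)"

lemma finite_edge: "e \<in> E \<Longrightarrow> finite e"
  using edgeD finite_subV by blast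

lemma finite_vars: "finite vars"
  unfolding vars_def using finite_E finite_pairs finite_edge by (intro finite_Plus finite_cartesian_product finite_SigmaI)

lemma bij_enum: "bij_betw enum vars {..<card vars}"
proof -
  have "\<exists>g. bij_betw g vars {..<card vars}"
    using ex_bij_betw_finite_nat[OF finite_vars] by (simp add: lessThan_atLeast0)
  then show ?thesis unfolding enum_def by (rule someI_ex)
qed

lemma coord_realize:
  "\<exists>z\<in>coord_space {..<card vars}. \<forall>j\<in>vars. coord z j = val j"
proof (intro bexI ballI)
  define z where "z = (\<Sum>j\<in>vars. Poly_Mapping.single (enum j) (val j))"
  have z: "Poly_Mapping.lookup z n = (\<Sum>j\<in>vars. if enum j = n then val j else 0)" for n
    by (simp add: z_def lookup_sum lookup_single when_def)
  show "z \<in> coord_space {..<card vars}"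
    unfolding coord_space_iff z using bij_enum by (auto simp: bij_betw_def intro!: sum.neutral)
  fix j assume j: "j \<in> vars"
  have "coord z j = (\<Sum>i\<in>vars. if i = j then val i else 0)"
    unfolding coord_def z using bij_enum j
    by (intro sum.cong) (auto simp: bij_betw_def inj_on_eq_iff)
  then show "coord z j = val j" using j finite_vars by simp
qed

lemma coord_add [simp]: "coord (y + z) j = coord y j + coord z j"
  and coord_scale [simp]: "coord (r *\<^sub>R z) j = r * coord z j"
  by (simp_all add: coord_def lookup_add)

definition ext_space :: "(nat \<Rightarrow>\<^sub>0 real) set" where
  "ext_space = {z \<in> coord_space {..<card vars}. \<forall>d\<in>pairs.
     (\<forall>e\<in>E. (\<Sum>w\<in>e. coord z (Inr (d, e, w))) = coord z (Inl e)) \<and>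
     (\<forall>w\<in>V. (\<Sum>e | e \<in> E \<and> w \<in> e. coord z (Inr (d, e, w))) = real_of_int (cap d w))}"

text \<open>One inequality per variable: an upper bound for edge weights, nonnegativity for
  orientation variables. The edge equations of \<open>ext_space\<close> imply the remaining
  bounds.\<close>

definition ext_val :: "'v set + ('v \<times> 'v) \<times> 'v set \<times> 'v \<Rightarrow> (nat \<Rightarrow>\<^sub>0 real) \<Rightarrow> real" where
  "ext_val j z = (case j of Inl _ \<Rightarrow> coord z j | Inr _ \<Rightarrow> - coord z j)"

definition ext_bound :: "'v set + ('v \<times> 'v) \<times> 'v set \<times> 'v \<Rightarrow> real" where
  "ext_bound j = (case j of Inl _ \<Rightarrow> 1 | Inr _ \<Rightarrow> 0)"

lemma polyhedron_rep_ext: "polyhedron_rep ext_space vars ext_val"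
  unfolding polyhedron_rep_def
proof (intro conjI allI impI)
  show "affine ext_space"
    by (auto simp: affine_def ext_space_def coord_space_iff lookup_add sum.distrib
        simp flip: sum_distrib_left distrib_right)
  show "finite vars" by (rule finite_vars)
  show "linear (ext_val j)" for j
    by (rule linearI) (auto simp: ext_val_def split: sum.splits)
qed

sublocale ext: polyhedron_rep ext_space vars ext_val ext_bound
  by (rule polyhedron_rep_ext)

lemma ext_spaceD:
  assumes "z \<in> ext_space" "d \<in> pairs"
  shows "e \<in> E \<Longrightarrow> (\<Sum>w\<in>e. coord z (Inr (d, e, w))) = coord z (Inl e)"
    and "w \<in> V \<Longrightarrow> (\<Sum>e | e \<in> E \<and> w \<in> e. coord z (Inr (d, e, w))) = real_of_int (cap d w)"
  using assms by (auto simp: ext_space_def)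

lemma ext_carrierD:
  assumes "z \<in> ext.carrier"
  shows "z \<in> ext_space" "e \<in> E \<Longrightarrow> coord z (Inl e) \<le> 1"
    "d \<in> pairs \<Longrightarrow> e \<in> E \<Longrightarrow> w \<in> e \<Longrightarrow> 0 \<le> coord z (Inr (d, e, w))"
proof -
  have z: "z \<in> ext_space" "\<forall>j\<in>vars. ext_val j z \<le> ext_bound j"
    using assms by (auto simp: ext.carrier_def)
  show "z \<in> ext_space" by (rule z)
  show "coord z (Inl e) \<le> 1" if "e \<in> E"
    using bspec[OF z(2), of "Inl e"] that by (simp add: ext_val_def ext_bound_def)
  show "0 \<le> coord z (Inr (d, e, w))" if "d \<in> pairs" "e \<in> E" "w \<in> e"
    using bspec[OF z(2), of "Inr (d, e, w)"] that by (simp add: ext_val_def ext_bound_def)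
qed

lemma ext_carrierI:
  assumes "z \<in> ext_space" "\<And>e. e \<in> E \<Longrightarrow> coord z (Inl e) \<le> 1"
    "\<And>d e w. d \<in> pairs \<Longrightarrow> e \<in> E \<Longrightarrow> w \<in> e \<Longrightarrow> 0 \<le> coord z (Inr (d, e, w))"
  shows "z \<in> ext.carrier"
proof -
  have "ext_val j z \<le> ext_bound j" if j: "j \<in> vars" for j
    using j assms(2,3) by (cases j) (auto simp: ext_val_def ext_bound_def)
  then show ?thesis using assms(1) by (simp add: ext.carrier_def)
qed

text \<open>As soon as there is an edge there is an orientation, whose nonnegative parts bound the
  edge weights from below.\<close>

lemma edge_pair: "e \<in> E \<Longrightarrow> \<exists>d. d \<in> pairs"
  using edgeD[of e] by (auto simp: card_2_iff pairs_def)

lemma ext_edge_bounds: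
  assumes z: "z \<in> ext.carrier" and e: "e \<in> E"
  shows "0 \<le> coord z (Inl e)" "coord z (Inl e) \<le> 1"
proof -
  obtain d where d: "d \<in> pairs" using edge_pair[OF e] by blast
  have "0 \<le> (\<Sum>w\<in>e. coord z (Inr (d, e, w)))"
    using z d e by (intro sum_nonneg ext_carrierD(3))
  then show "0 \<le> coord z (Inl e)" by (simp add: ext_spaceD(1)[OF ext_carrierD(1)[OF z] d e])
  show "coord z (Inl e) \<le> 1" by (rule ext_carrierD(2)[OF z e])
qed

lemma coordinates_ext_carrier:
  assumes z: "z \<in> ext.carrier"
  shows "\<bar>Poly_Mapping.lookup z n\<bar> \<le> 1"
proof (cases "n < card vars")
  case True
  then have "n \<in> enum ` vars" using bij_enum by (simp add: bij_betw_def)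
  then obtain j where j: "j \<in> vars" "n = enum j" by blast
  have "\<bar>coord z j\<bar> \<le> 1"
  proof (cases j)
    case (Inl e)
    then have "e \<in> E" using j(1) by simp
    then show ?thesis using ext_edge_bounds[OF z] Inl by simp
  next
    case (Inr q)
    then obtain d e w where q: "j = Inr (d, e, w)" "d \<in> pairs" "e \<in> E" "w \<in> e"
      using j(1) by (auto simp: vars_def)
    have nonneg: "0 \<le> coord z (Inr (d, e, w'))" if "w' \<in> e" for w'
      using z q(2,3) that by (rule ext_carrierD(3))
    have "coord z j \<le> (\<Sum>w\<in>e. coord z (Inr (d, e, w)))"
      unfolding q(1) using q(4) nonneg finite_edge[OF q(3)]
      by (intro member_le_sum[where f = "\<lambda>w. coord z (Inr (d, e, w))"]) auto
    also have "\<dots> = coord z (Inl e)" by (rule ext_spaceD(1)[OF ext_carrierD(1)[OF z] q(2,3)])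
    also have "\<dots> \<le> 1" by (rule ext_edge_bounds[OF z q(3)])
    finally show ?thesis using nonneg[OF q(4)] q(1) by simp
  qed
  then show ?thesis using j(2) by (simp add: coord_def)
next
  case False
  then show ?thesis using ext_carrierD(1)[OF z] by (simp add: ext_space_def coord_space_iff)
qed

lemma polytope_ext: "polytope ext.carrier"
proof -
  have "ext.carrier = convex hull ext.vertices"
  proof (rule ext.carrier_eq_hull_vertices)
    fix x y
    assume "x \<in> ext.carrier" "y \<noteq> x"
    then show "\<exists>t>0. x + t *\<^sub>R (y - x) \<notin> ext.carrier"
      by (rule leave_bounded_coordinates[where S = ext.carrier, rotated]) (rule coordinates_ext_carrier)
  qed
  then show ?thesis using ext.finite_vertices unfolding polytope_def by blast
qed

section \<open>Projection onto the edge weights\<close>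

definition proj :: "(nat \<Rightarrow>\<^sub>0 real) \<Rightarrow> ('v set \<Rightarrow>\<^sub>0 real)" where
  "proj z = (\<Sum>e\<in>E. Poly_Mapping.single e (coord z (Inl e)))"

lemma lookup_proj: "Poly_Mapping.lookup (proj z) e = (if e \<in> E then coord z (Inl e) else 0)"
  unfolding proj_def by (rule lookup_sum_single[OF finite_E])

lemma linear_proj: "linear proj"
  by (rule linearI; rule poly_mapping_eqI) (simp_all add: lookup_proj lookup_add)

lemma proj_eqI:
  assumes "x \<in> coord_space E" "\<And>e. e \<in> E \<Longrightarrow> coord z (Inl e) = Poly_Mapping.lookup x e"
  shows "proj z = x"
  using assms by (intro poly_mapping_eqI) (auto simp: lookup_proj coord_space_iff)

lemma proj_coord_space: "proj ` coord_space {..<card vars} = coord_space E"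
proof
  show "proj ` coord_space {..<card vars} \<subseteq> coord_space E"
    by (auto simp: coord_space_iff lookup_proj)
  show "coord_space E \<subseteq> proj ` coord_space {..<card vars}"
  proof
    fix x assume x: "x \<in> coord_space E"
    obtain z where z: "z \<in> coord_space {..<card vars}"
      "\<forall>j\<in>vars. coord z j = (case j of Inl e \<Rightarrow> Poly_Mapping.lookup x e | Inr _ \<Rightarrow> 0)"
      using coord_realize[of "\<lambda>j. case j of Inl e \<Rightarrow> Poly_Mapping.lookup x e | Inr _ \<Rightarrow> 0"] by blast
    then have "proj z = x" by (intro proj_eqI[OF x]) simp
    then show "x \<in> proj ` coord_space {..<card vars}" using z(1) by blast
  qed
qed

text \<open>
  Summing the in-degrees over \<open>U\<close> counts every edge inside \<open>U\<close> fully; the rest of the sum, the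
  weight entering \<open>U\<close>, is the slack of the inequality for \<open>U\<close>.
\<close>
lemma proj_ext_in_base:
  assumes z: "z \<in> ext.carrier" and V2: "2 \<le> card V"
  shows "proj z \<in> base.carrier"
proof -
  have zs: "z \<in> ext_space" by (rule ext_carrierD(1)[OF z])
  \<comment> \<open>Double counting: split each edge of \<open>A\<close> into its directed parts and
    collect these by head.\<close>
  have x_sum: "x_sum (proj z) A = (\<Sum>w\<in>U. \<Sum>e | e \<in> A \<and> w \<in> e. coord z (Inr (d, e, w)))"
    if A: "A \<subseteq> E" "\<And>e. e \<in> A \<Longrightarrow> e \<subseteq> U" and U: "finite U" and d: "d \<in> pairs" for A U d
  proof -
    have "x_sum (proj z) A = (\<Sum>e\<in>A. \<Sum>w | w \<in> U \<and> w \<in> e. coord z (Inr (d, e, w)))"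
    proof (rule sum.cong[OF refl])
      fix e assume e: "e \<in> A"
      then have "{w. w \<in> U \<and> w \<in> e} = e" using A(2) by blast
      then show "Poly_Mapping.lookup (proj z) e = (\<Sum>w | w \<in> U \<and> w \<in> e. coord z (Inr (d, e, w)))"
        using ext_spaceD(1)[OF zs d, of e] A(1) e by (auto simp: lookup_proj)
    qed
    also have "\<dots> = (\<Sum>w\<in>U. \<Sum>e | e \<in> A \<and> w \<in> e. coord z (Inr (d, e, w)))"
      using finite_subset[OF A(1) finite_E] U by (rule sum.swap_restrict)
    finally show ?thesis .
  qed
  have in_degrees: "(\<Sum>w\<in>U. \<Sum>e | e \<in> E \<and> w \<in> e. coord z (Inr (d, e, w))) =
      real_of_int (k * int (card U) - l)" if U: "U \<subseteq> V" "fst d \<in> U" "snd d \<in> U" and d: "d \<in> pairs" for U d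
  proof -
    have "(\<Sum>w\<in>U. \<Sum>e | e \<in> E \<and> w \<in> e. coord z (Inr (d, e, w))) = (\<Sum>w\<in>U. real_of_int (cap d w))"
      using ext_spaceD(2)[OF zs d] U(1) by (intro sum.cong) auto
    also have "\<dots> = real_of_int (sum (cap d) U)" by simp
    also have "sum (cap d) U = k * int (card U) - l"
      using sum_cap[OF d finite_subV[OF U(1)]] U by simp
    finally show ?thesis .
  qed
  \<comment> \<open>Each count inequality uses a pair inside its own \<open>U\<close>, hence one
    orientation for every pair.\<close>
  have pair: "\<exists>d\<in>pairs. fst d \<in> U \<and> snd d \<in> U" if U: "U \<subseteq> V" "2 \<le> card U" for U
  proof -
    obtain T where "T \<subseteq> U" "card T = 2"
      using obtain_subset_with_card_n[OF U(2)] by blast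
    then obtain u v where "u \<in> U" "v \<in> U" "u \<noteq> v" by (auto simp: card_2_iff)
    then have "(u, v) \<in> pairs" using U(1) by (auto simp: pairs_def)
    then show ?thesis using \<open>u \<in> U\<close> \<open>v \<in> U\<close> by force
  qed
  show ?thesis
    unfolding base_carrier_iff
  proof (intro conjI allI impI ballI)
    show "proj z \<in> coord_space E" by (auto simp: coord_space_iff lookup_proj)
    obtain d where d: "d \<in> pairs" "fst d \<in> V" "snd d \<in> V" using pair[OF _ V2] by blast
    have "x_sum (proj z) E = (\<Sum>w\<in>V. \<Sum>e | e \<in> E \<and> w \<in> e. coord z (Inr (d, e, w)))"
      using edgeD d(1) finite_V by (intro x_sum) auto
    also have "\<dots> = real_of_int (k * int (card V) - l)"
      using d by (intro in_degrees) auto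
    finally show "x_sum (proj z) E = real_of_int (k * int (card V) - l)" .
  next
    fix e assume "e \<in> E"
    then show "0 \<le> Poly_Mapping.lookup (proj z) e" "Poly_Mapping.lookup (proj z) e \<le> 1"
      using ext_edge_bounds[OF z] by (simp_all add: lookup_proj)
  next
    fix U assume "U \<subseteq> V \<and> 2 \<le> card U"
    then have U: "U \<subseteq> V" "2 \<le> card U" by auto
    obtain d where d: "d \<in> pairs" "fst d \<in> U" "snd d \<in> U" using pair[OF U] by blast
    have "x_sum (proj z) (induced E U) =
        (\<Sum>w\<in>U. \<Sum>e | e \<in> induced E U \<and> w \<in> e. coord z (Inr (d, e, w)))"
      using d(1) finite_subV[OF U(1)] by (intro x_sum) (auto simp: induced_def)
    also have "\<dots> \<le> (\<Sum>w\<in>U. \<Sum>e | e \<in> E \<and> w \<in> e. coord z (Inr (d, e, w)))"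
      using ext_carrierD(3)[OF z d(1)] finite_E by (intro sum_mono sum_mono2) (auto simp: induced_def)
    also have "\<dots> = real_of_int (k * int (card U) - l)"
      using d U by (intro in_degrees) auto
    finally show "x_sum (proj z) (induced E U) \<le> real_of_int (k * int (card U) - l)" .
  qed
qed

text \<open>One integral orientation per pair, written as 0/1 values of the orientation variables,
  satisfies the equations of \<open>ext_space\<close>.\<close>

lemma tight_lifts:
  assumes F: "F \<subseteq> E" "tight k l V F"
  shows "incidence_vector F \<in> proj ` ext.carrier"
proof -
  have finF: "finite F" using F(1) finite_E by (rule finite_subset)
  have "\<forall>d\<in>pairs. \<exists>h. (\<forall>e\<in>F. h e \<in> e) \<and> (\<forall>w\<in>V. int (card {e\<in>F. h e = w}) = cap d w)"
    using tight_orientation[OF F] by blast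
  then obtain h where h: "\<forall>d\<in>pairs. (\<forall>e\<in>F. h d e \<in> e) \<and> (\<forall>w\<in>V. int (card {e\<in>F. h d e = w}) = cap d w)"
    by (rule bchoice[THEN exE])
  define val :: "_ \<Rightarrow> real" where "val j = (case j of Inl e \<Rightarrow> if e \<in> F then 1 else 0
    | Inr (d, e, w) \<Rightarrow> if e \<in> F \<and> h d e = w then 1 else 0)"
    for j :: "'v set + ('v \<times> 'v) \<times> 'v set \<times> 'v"
  obtain z where z: "z \<in> coord_space {..<card vars}" "\<forall>j\<in>vars. coord z j = val j"
    using coord_realize[of val] by blast
  have z_Inl: "coord z (Inl e) = (if e \<in> F then 1 else 0)" if "e \<in> E" for e
    using z(2) that by (simp add: val_def)
  have z_Inr: "coord z (Inr (d, e, w)) = (if e \<in> F \<and> h d e = w then 1 else 0)"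
    if "d \<in> pairs" "e \<in> E" "w \<in> e" for d e w
    using z(2) that by (simp add: val_def)
  have edge_eq: "(\<Sum>w\<in>e. coord z (Inr (d, e, w))) = coord z (Inl e)" if de: "d \<in> pairs" "e \<in> E" for d e
  proof -
    have "(\<Sum>w\<in>e. coord z (Inr (d, e, w))) = (\<Sum>w\<in>e. if h d e = w then if e \<in> F then 1 else 0 else 0)"
      using de by (intro sum.cong) (auto simp: z_Inr)
    also have "\<dots> = (if e \<in> F then 1 else 0)"
      using h de finite_edge[OF de(2)] by auto
    finally show ?thesis using z_Inl[OF de(2)] by simp
  qed
  have vertex_eq: "(\<Sum>e | e \<in> E \<and> w \<in> e. coord z (Inr (d, e, w))) = real_of_int (cap d w)"
    if dw: "d \<in> pairs" "w \<in> V" for d w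
  proof -
    have "(\<Sum>e | e \<in> E \<and> w \<in> e. coord z (Inr (d, e, w))) =
        (\<Sum>e | e \<in> E \<and> w \<in> e. if e \<in> F \<and> h d e = w then 1 else 0)"
      using dw by (intro sum.cong) (auto simp: z_Inr)
    also have "\<dots> = (\<Sum>e \<in> {e\<in>F. h d e = w}. 1)"
      using h dw F(1) finite_E by (intro sum.mono_neutral_cong_right) auto
    also have "\<dots> = real_of_int (int (card {e\<in>F. h d e = w}))" by simp
    also have "int (card {e\<in>F. h d e = w}) = cap d w" using h dw by blast
    finally show ?thesis .
  qed
  have "z \<in> ext.carrier"
    using z(1) edge_eq vertex_eq by (intro ext_carrierI) (auto simp: ext_space_def z_Inl z_Inr)
  moreover have "proj z = incidence_vector F"
    using F(1) finF by (intro proj_eqI) (auto simp: coord_space_iff lookup_incidence_vector z_Inl)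
  ultimately show ?thesis by (metis imageI)
qed

text \<open>One inclusion lifts the generating incidence vectors and uses convexity; the other
  passes through the integral polytope \<open>base.carrier\<close>.\<close>

lemma proj_ext: "proj ` ext.carrier = tight_polytope k l V E"
proof
  show "tight_polytope k l V E \<subseteq> proj ` ext.carrier"
    unfolding tight_polytope_def
    by (rule hull_minimal)
      (use tight_lifts convex_linear_image[OF linear_proj ext.convex_carrier] in auto)
  have "proj z \<in> tight_polytope k l V E" if z: "z \<in> ext.carrier" for z
  proof (cases "2 \<le> card V")
    case True
    then show ?thesis using base_carrier_subset proj_ext_in_base[OF z] by blast
  next
    case False
    \<comment> \<open>With at most one vertex there are no edges, and
      \<open>k * int (card V) \<le> l\<close> makes the empty set tight through the maximum with 0;
      its incidence vector is the only projected point.\<close>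
    have "E = {}"
      using edge_pair card_V_of_pair False by blast
    moreover have "k * int (card V) \<le> l"
    proof -
      have "k * int (card V) \<le> k * 1" using False k_pos by (intro mult_left_mono) auto
      then show ?thesis using k_le_l by simp
    qed
    ultimately have "tight k l V {}" by (simp add: tight_def sparse_def)
    then have "incidence_vector {} \<in> tight_polytope k l V E"
      unfolding tight_polytope_def by (intro hull_inc) auto
    moreover have "e \<notin> E" for e using \<open>E = {}\<close> by simp
    then have "proj z = incidence_vector {}"
      by (intro poly_mapping_eqI) (simp add: lookup_proj lookup_incidence_vector)
    ultimately show ?thesis by simp
  qed
  then show "proj ` ext.carrier \<subseteq> tight_polytope k l V E" by auto
qed

section \<open>Counting the variables\<close>

lemma card_vars: "card vars = card E + card pairs * (2 * card E)"
proof -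
  have "card (SIGMA e:E. e) = (\<Sum>e\<in>E. card e)"
    using finite_E finite_edge by (intro card_SigmaI) auto
  also have "\<dots> = (\<Sum>e\<in>E. 2)" using edgeD by (intro sum.cong) auto
  finally have "card (SIGMA e:E. e) = 2 * card E" by simp
  then show ?thesis
    using finite_E finite_pairs finite_edge
    by (simp add: vars_def card_Plus finite_SigmaI card_cartesian_product)
qed

text \<open>The constant is 1 + 2: the edge variables are absorbed since an edge forces
  \<open>card V\<close> to be positive, and each of the at most \<open>(card V)\<^sup>2\<close>
  pairs has two variables per edge.\<close>

lemma card_vars_le: "card vars \<le> 3 * (card V)\<^sup>2 * card E"
proof (cases "E = {}")
  case False
  then have "2 \<le> card V" using edge_pair card_V_of_pair by blast
  then have "1 \<le> (card V)\<^sup>2" by (simp add: Suc_leI)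
  then have "1 * card E \<le> (card V)\<^sup>2 * card E" by (intro mult_right_mono) auto
  moreover have "card pairs \<le> card (V \<times> V)"
    using finite_V by (intro card_mono) (auto simp: pairs_def)
  then have "card pairs * (2 * card E) \<le> (card V)\<^sup>2 * (2 * card E)"
    by (intro mult_right_mono) (auto simp: card_cartesian_product power2_eq_square)
  ultimately have "card vars \<le> (card V)\<^sup>2 * card E + (card V)\<^sup>2 * (2 * card E)"
    by (simp only: card_vars mult_1)
  then show ?thesis by (simp add: algebra_simps)
next
  case True
  then have "card E = 0" by simp
  then show ?thesis by (simp only: card_vars)
qed

lemma extended_formulation_ext:
  "extended_formulation E (tight_polytope k l V E) (card vars) ext.carrier"
  unfolding extended_formulation_def
proof (intro conjI exI)
  show "card E \<le> card vars" by (simp add: card_vars)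
  show "ext.carrier \<subseteq> coord_space {..<card vars}"
    using ext_carrierD(1) unfolding ext_space_def by blast
qed (fact polytope_ext linear_proj proj_coord_space proj_ext)+

end

theorem theorem2:
  shows "\<exists>C::real. \<forall>(k::int) (l::int) (V::'v set) (E::'v set set).
    0 \<le> k \<and> k \<le> l \<and> l \<le> 2 * k - 1 \<and> simple_graph V E \<longrightarrow>
    (\<exists>p Q. extended_formulation E (tight_polytope k l V E) p Q \<and>
           real (num_facets Q) \<le> C * (real (card V))\<^sup>2 * real (card E))"
proof (rule exI[of _ 3], intro allI impI)
  fix k l :: int and V :: "'v set" and E :: "'v set set"
  assume "0 \<le> k \<and> k \<le> l \<and> l \<le> 2 * k - 1 \<and> simple_graph V E"
  then interpret count_graph k l V E by unfold_locales auto
  have "num_facets ext.carrier \<le> 3 * (card V)\<^sup>2 * card E"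
    using ext.num_facets_le[OF polytope_ext] card_vars_le by (rule order_trans)
  then have "real (num_facets ext.carrier) \<le> real (3 * (card V)\<^sup>2 * card E)"
    by (rule of_nat_mono)
  then have "real (num_facets ext.carrier) \<le> 3 * (real (card V))\<^sup>2 * real (card E)"
    by simp
  then show "\<exists>p Q. extended_formulation E (tight_polytope k l V E) p Q \<and>
      real (num_facets Q) \<le> 3 * (real (card V))\<^sup>2 * real (card E)"
    using extended_formulation_ext by blast
qed

end
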